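(* For every set $X\subseteq 2^\omega$ we have: (1) if $X$ has the Baire property, then $X$ is weakly $\mathbb{FSP}$-measurable; (2) if $X$ is Lebesgue-measurable, then $X$ is weakly $\mathbb{FSP}$-measurable.
   Context: A tree is a nonempty set $p \subseteq 2^{<\omega}$ closed under initial segments ($\trianglelefteq$ denotes the initial segment relation and $\triangleleft$ its strict version; $|t|$ is the length of $t$). A node $t\in p$ is splitting if both $t^\frown 0, t^\frown 1 \in p$; $\mathrm{Split}(p)$ is the set of splitting nodes. $p$ is perfect if every node of $p$ is extended (not necessarily properly) by a splitting node of $p$. $\mathrm{Lev}_n(p)=\{t\in p: |t|=n\}$, $p\upharpoonright t=\{s\in p : s\trianglelefteq t \text{ or } t\triangleleft s\}$, and $[p]=\{f\in 2^\omega : \forall n\, (f\upharpoonright n\in p)\}$. $\mathbb{FSP}$ (fat splitting tree forcing) is the set of perfect trees $p\subseteq 2^{<\omega}$ such that for every $t\in p$ there is $k\in\omega$ such that for every $n\in\omega$ with $n\ge k-1$ there is $t'\in \mathrm{Lev}_n(p\upharpoonright t)$ with $t'\in\mathrm{Split}(p)$; ordered by $q\le p$ iff $q\subseteq p$. $X\subseteq 2^\omega$ is $\mathbb{FSP}$-nowhere dense if $\forall p\in\mathbb{FSP}\,\exists q\le p\ ([q]\cap X=\emptyset)$; $\mathcal{I}_{\mathbb{FSP}}$ is the $\sigma$-ideal of sets included in a countable union of $\mathbb{FSP}$-nowhere dense sets; $X\subseteq 2^\omega$ is weakly $\mathbb{FSP}$-measurable if there is $q\in\mathbb{FSP}$ with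 $[q]\setminus X\in\mathcal{I}_{\mathbb{FSP}}$ or $[q]\cap X\in\mathcal{I}_{\mathbb{FSP}}$. Lebesgue measurability refers to the standard (completed product) measure on $2^\omega$. *)

theory Defs
  imports "HOL-Probability.Probability" "HOL-Library.Sublist"
begin

text \<open>
  Finite binary sequences are lists of booleans (\<open>0\<close> is \<open>False\<close>, \<open>1\<close> is \<open>True\<close>), ordered by
  \<^const>\<open>prefix\<close>; points of Cantor space are functions from \<^typ>\<open>nat\<close> to \<^typ>\<open>bool\<close>.
\<close>

definition is_tree :: "bool list set \<Rightarrow> bool" where
  "is_tree p \<longleftrightarrow> p \<noteq> {} \<and> (\<forall>t\<in>p. \<forall>s. prefix s t \<longrightarrow> s \<in> p)"

definition Split :: "bool list set \<Rightarrow> bool list set" where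
  "Split p = {t \<in> p. t @ [False] \<in> p \<and> t @ [True] \<in> p}"

definition perfect_tree :: "bool list set \<Rightarrow> bool" where
  "perfect_tree p \<longleftrightarrow> is_tree p \<and> (\<forall>s\<in>p. \<exists>t\<in>Split p. prefix s t)"

definition Lev :: "nat \<Rightarrow> bool list set \<Rightarrow> bool list set" where
  "Lev n p = {t \<in> p. length t = n}"

definition restr :: "bool list set \<Rightarrow> bool list \<Rightarrow> bool list set" where
  "restr p t = {s \<in> p. prefix s t \<or> strict_prefix t s}"

definition branches :: "bool list set \<Rightarrow> (nat \<Rightarrow> bool) set" where
  "branches p = {f. \<forall>n. map f [0..<n] \<in> p}"

text \<open>The condition \<open>n \<ge> k - 1\<close> is written \<open>n + 1 \<ge> k\<close> to avoid truncated subtraction.\<close>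

definition FSP :: "bool list set set" where
  "FSP = {p. perfect_tree p \<and>
     (\<forall>t\<in>p. \<exists>k. \<forall>n. n + 1 \<ge> k \<longrightarrow> (\<exists>t'\<in>Lev n (restr p t). t' \<in> Split p))}"

definition FSP_nowhere_dense :: "(nat \<Rightarrow> bool) set \<Rightarrow> bool" where
  "FSP_nowhere_dense X \<longleftrightarrow> (\<forall>p\<in>FSP. \<exists>q\<in>FSP. q \<subseteq> p \<and> branches q \<inter> X = {})"

definition FSP_ideal :: "(nat \<Rightarrow> bool) set set" where
  "FSP_ideal = {X. \<exists>\<A>. countable \<A> \<and> (\<forall>A\<in>\<A>. FSP_nowhere_dense A) \<and> X \<subseteq> \<Union>\<A>}"

definition weakly_FSP_measurable :: "(nat \<Rightarrow> bool) set \<Rightarrow> bool" where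
  "weakly_FSP_measurable X \<longleftrightarrow>
     (\<exists>q\<in>FSP. branches q - X \<in> FSP_ideal \<or> branches q \<inter> X \<in> FSP_ideal)"

definition nowhere_dense :: "'a::topological_space set \<Rightarrow> bool" where
  "nowhere_dense S \<longleftrightarrow> interior (closure S) = {}"

definition meager :: "'a::topological_space set \<Rightarrow> bool" where
  "meager S \<longleftrightarrow> (\<exists>\<N>. countable \<N> \<and> (\<forall>N\<in>\<N>. nowhere_dense N) \<and> S \<subseteq> \<Union>\<N>)"

text \<open>
  On \<^typ>\<open>nat \<Rightarrow> bool\<close> the class topology is the product of the discrete topologies, that is,
  the usual topology of Cantor space.
\<close>

definition Baire_property :: "'a::topological_space set \<Rightarrow> bool" where
  "Baire_property X \<longleftrightarrow> (\<exists>U. open U \<and> meager ((X - U) \<union> (U - X)))"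

definition cantor_measure :: "(nat \<Rightarrow> bool) measure" where
  "cantor_measure = completion (\<Pi>\<^sub>M i\<in>UNIV. measure_pmf (bernoulli_pmf (1/2)))"

definition Lebesgue_measurable :: "(nat \<Rightarrow> bool) set \<Rightarrow> bool" where
  "Lebesgue_measurable X \<longleftrightarrow> X \<in> sets cantor_measure"

end

theory Submission
  imports Defs
begin

text \<open>
  Both parts hold in the strong form that some \<^term>\<open>q \<in> FSP\<close> has all its branches inside \<^term>\<open>X\<close>
  or all of them outside \<^term>\<open>X\<close>, so that the set required to be in the ideal is empty. Such
  trees come from two sources: below each cylinder there is a fat splitting tree whose branches
  avoid a given meager set, and inside each set of positive measure there are all branches of one.

  Category. Every meager set \<^term>\<open>A\<close> is controlled by a point \<^term>\<open>e\<close> and a partition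
  of the natural numbers into consecutive blocks: a point that agrees with \<^term>\<open>e\<close> on infinitely
  many blocks is not in \<^term>\<open>A\<close> (\<open>meager_avoided_by_matching\<close>). Pair up the blocks and
  require agreement with \<^term>\<open>e\<close> on at least one block of each pair. This forces infinitely many
  agreements, and yet a point that copies \<^term>\<open>e\<close> from somewhere on may be changed at any
  far coordinate: if this lies in one block of a pair, the other block still agrees.
  Hence the initial segments of the points meeting the requirement form a fat splitting tree
  (\<open>matching_tree_FSP\<close>). If \<^term>\<open>X\<close> differs from the open set \<^term>\<open>U\<close>
  by a meager set, such a tree is built below a cylinder contained in \<^term>\<open>U\<close>, or anywhere
  when \<^term>\<open>U\<close> is empty.

  Measure. One of \<^term>\<open>X\<close> and its complement has positive measure, so it contains a closed set
  \<^term>\<open>K\<close> of positive measure. Let \<^term>\<open>q\<close> consist of the strings whose cylinder meets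
  \<^term>\<open>K\<close> in positive measure; its branches lie in \<^term>\<open>K\<close> because \<^term>\<open>K\<close> is closed.
  Fatness is a counting matter (\<open>eventually_split\<close>): the proportion of strings of length
  \<open>n\<close> that extend a given \<^term>\<open>t \<in> q\<close> and belong to \<^term>\<open>q\<close> decreases with \<open>n\<close> but stays
  above a positive bound. At a level without a splitting node above \<^term>\<open>t\<close> this proportion is at
  least halved, which therefore happens only finitely often.
\<close>

section \<open>Trees and cylinders\<close>

text \<open>
  Perfectness asks for one splitting node above each node, which fatness supplies at every
  sufficiently high level.
\<close>
lemma FSP_I:
  assumes "is_tree p"
    and fat: "\<And>t. t \<in> p \<Longrightarrow> \<exists>k. \<forall>n\<ge>k. \<exists>t'\<in>Split p. length t' = n \<and> prefix t t'"
  shows "p \<in> FSP"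
proof -
  have "\<exists>t'\<in>Split p. prefix t t'" if "t \<in> p" for t
    using fat[OF that] by blast
  moreover have "\<exists>k. \<forall>n. n + 1 \<ge> k \<longrightarrow> (\<exists>t'\<in>Lev n (restr p t). t' \<in> Split p)" if t: "t \<in> p" for t
  proof -
    obtain k where k: "\<And>n. n \<ge> k \<Longrightarrow> \<exists>t'\<in>Split p. length t' = n \<and> prefix t t'"
      using fat[OF t] by blast
    have "\<exists>t'\<in>Lev n (restr p t). t' \<in> Split p" if "n + 1 \<ge> Suc k" for n
    proof -
      obtain t' where t': "t' \<in> Split p" "length t' = n" "prefix t t'"
        using k[of n] \<open>n + 1 \<ge> Suc k\<close> by auto
      then have "t' \<in> Lev n (restr p t)"
        by (auto simp: Lev_def restr_def Split_def strict_prefix_def)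
      then show ?thesis using t'(1) by blast
    qed
    then show ?thesis by blast
  qed
  ultimately show ?thesis
    using assms(1) by (simp add: FSP_def perfect_tree_def)
qed

lemma weakly_FSP_measurable_if_branches_decided:
  assumes "q \<in> FSP" and "branches q \<subseteq> X \<or> branches q \<inter> X = {}"
  shows "weakly_FSP_measurable X"
proof -
  have "{} \<in> FSP_ideal"
    by (auto simp: FSP_ideal_def intro!: exI[of _ "{}"])
  moreover have "branches q - X = {} \<or> branches q \<inter> X = {}"
    using assms(2) by blast
  ultimately have "branches q - X \<in> FSP_ideal \<or> branches q \<inter> X \<in> FSP_ideal"
    by metis
  then show ?thesis
    using assms(1) by (auto simp: weakly_FSP_measurable_def)
qed

definition cylinder :: "bool list \<Rightarrow> (nat \<Rightarrow> bool) set" where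
  "cylinder s = {f. map f [0..<length s] = s}"

lemma cylinder_iff: "f \<in> cylinder s \<longleftrightarrow> (\<forall>i<length s. f i = s ! i)"
  unfolding cylinder_def mem_Collect_eq by (subst list_eq_iff_nth_eq) simp

lemma cylinder_append_subset: "cylinder (s @ u) \<subseteq> cylinder s"
  by (auto simp: cylinder_iff nth_append)

lemma mem_cylinder_initial: "f \<in> cylinder (map f [0..<n])"
  by (simp add: cylinder_iff)

lemma mem_cylinder_snoc: "f \<in> cylinder (s @ [c]) \<longleftrightarrow> f \<in> cylinder s \<and> f (length s) = c"
  by (simp add: cylinder_def)

lemma cylinder_snoc: "cylinder s = cylinder (s @ [False]) \<union> cylinder (s @ [True])"
  "cylinder (s @ [False]) \<inter> cylinder (s @ [True]) = {}"
  by (auto simp: mem_cylinder_snoc)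

lemma cylinder_nonempty: "cylinder s \<noteq> {}"
  using cylinder_iff[of "\<lambda>i. s ! i" s] by auto

lemma open_coordinate: "open {f :: nat \<Rightarrow> bool. f i = b}"
proof -
  have "open ((\<lambda>f :: nat \<Rightarrow> bool. f i) -` {b})"
    by (intro open_vimage continuous_on_product_coordinates) (rule discrete_topology_class.open_discrete)
  then show ?thesis by (simp add: vimage_def)
qed

lemma open_cylinder: "open (cylinder s)"
proof -
  have "cylinder s = (\<Inter>i\<in>{..<length s}. {f. f i = s ! i})"
    by (auto simp: cylinder_iff)
  then show ?thesis
    by (auto intro!: open_INT open_coordinate)
qed

lemma open_contains_cylinder:
  assumes "open U" "f \<in> U"
  shows "\<exists>n. cylinder (map f [0..<n]) \<subseteq> U"
proof -
  obtain X where X: "f \<in> Pi\<^sub>E UNIV X" "finite {i. X i \<noteq> UNIV}" "Pi\<^sub>E UNIV X \<subseteq> U"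
    using product_topology_open_contains_basis[of "\<lambda>_. euclidean" UNIV U f] assms
    by (auto simp: open_fun_def topspace_euclidean)
  obtain n where n: "\<And>i. X i \<noteq> UNIV \<Longrightarrow> i < n"
    using finite_nat_set_iff_bounded[THEN iffD1, OF X(2)] by auto
  have "g \<in> Pi\<^sub>E UNIV X" if "g \<in> cylinder (map f [0..<n])" for g
  proof (rule PiE_I)
    fix i
    show "g i \<in> X i"
    proof (cases "X i = UNIV")
      case False
      then have "g i = f i" using that n[of i] by (simp add: cylinder_iff)
      then show ?thesis using X(1) by auto
    qed simp
  qed simp
  then show ?thesis using X(3) by blast
qed

section \<open>Baire category\<close>

lemma nowhere_dense_cylinder_avoids:
  assumes "nowhere_dense (N :: (nat \<Rightarrow> bool) set)"
  shows "\<exists>u. cylinder (s @ u) \<inter> N = {}"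
proof -
  have "\<not> cylinder s \<subseteq> closure N"
    using assms cylinder_nonempty[of s] interior_maximal[OF _ open_cylinder]
    unfolding nowhere_dense_def by blast
  then obtain f where f: "f \<in> cylinder s" "f \<in> - closure N" by blast
  obtain n where n: "cylinder (map f [0..<n]) \<subseteq> - closure N"
    using open_contains_cylinder[OF _ f(2)] by auto
  define u where "u = map f [length s..<max n (length s)]"
  have su: "s @ u = map f [0..<max n (length s)]"
    using f(1) by (intro nth_equalityI) (auto simp: cylinder_iff u_def nth_append)
  have "cylinder (s @ u) \<subseteq> cylinder (map f [0..<n])"
    unfolding su by (auto simp: cylinder_iff)
  then show ?thesis using n closure_subset[of N] by blast
qed

text \<open>
  A single continuation serves finitely many strings and nowhere dense sets simultaneously: handle
  the pairs one after another, each time lengthening the word. Asking for a nonempty word makes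
  the blocks formed from such words nonempty.
\<close>
lemma uniform_avoiding_word:
  assumes "finite P" and "\<And>s N. (s, N) \<in> P \<Longrightarrow> nowhere_dense N"
  shows "\<exists>u. u \<noteq> [] \<and> (\<forall>(s, N)\<in>P. cylinder (s @ u) \<inter> N = {})"
  using assms
proof (induction P rule: finite_induct)
  case empty
  show ?case by auto
next
  case (insert x P)
  obtain s N where x: "x = (s, N)" by force
  have "\<exists>u. u \<noteq> [] \<and> (\<forall>(s, N)\<in>P. cylinder (s @ u) \<inter> N = {})"
    by (rule insert.IH) (metis insert.prems insertI2)
  then obtain u where u: "u \<noteq> []" "\<And>s N. (s, N) \<in> P \<Longrightarrow> cylinder (s @ u) \<inter> N = {}"
    by blast
  obtain v where v: "cylinder ((s @ u) @ v) \<inter> N = {}"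
    using nowhere_dense_cylinder_avoids[of N "s @ u"] insert.prems x by blast
  have "cylinder (s' @ u @ v) \<inter> N' = {}" if "(s', N') \<in> P" for s' N'
    using u(2)[OF that] cylinder_append_subset[of "s' @ u" v] by auto
  then show ?case using u(1) v x by (intro exI[of _ "u @ v"]) auto
qed

text \<open>The \<open>j\<close>-th block is the half-open interval from \<^term>\<open>b j\<close> to \<^term>\<open>b (Suc j)\<close>.\<close>
definition agrees_on_block :: "(nat \<Rightarrow> bool) \<Rightarrow> (nat \<Rightarrow> nat) \<Rightarrow> nat \<Rightarrow> (nat \<Rightarrow> bool) \<Rightarrow> bool" where
  "agrees_on_block e b j x \<longleftrightarrow> (\<forall>i. b j \<le> i \<and> i < b (Suc j) \<longrightarrow> x i = e i)"

text \<open>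
  Write the meager set as a union of nowhere dense sets \<open>N i\<close>. The word placed on block \<open>j\<close>
  is chosen so that, whatever precedes it, it leads into a cylinder disjoint from all \<open>N i\<close> with
  \<open>i \<le> j\<close>. A single agreement on block \<open>j\<close> avoids just these, so infinitely many agreements
  avoid every \<open>N i\<close>.
\<close>
lemma meager_avoided_by_matching:
  assumes "meager (A :: (nat \<Rightarrow> bool) set)"
  obtains e b where "strict_mono b"
    and "\<And>x. \<exists>\<^sub>\<infinity>j. agrees_on_block e b j x \<Longrightarrow> x \<notin> A"
proof -
  obtain \<N> where \<N>: "countable \<N>" "\<And>N. N \<in> \<N> \<Longrightarrow> nowhere_dense N" "A \<subseteq> \<Union>\<N>"
    using assms by (auto simp: meager_def)
  \<comment> \<open>Inserting the empty set makes the family nonempty, so that it can be enumerated.\<close>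
  define N where "N = from_nat_into (insert {} \<N>)"
  have ran: "range N = insert {} \<N>"
    unfolding N_def using \<N>(1) by (intro range_from_nat_into) auto
  have nd: "nowhere_dense (N i)" for i
  proof -
    have "N i \<in> insert {} \<N>" using ran by blast
    then show ?thesis using \<N>(2) by (auto simp: nowhere_dense_def)
  qed
  have "\<forall>j n. \<exists>u. u \<noteq> [] \<and> (\<forall>(s, M)\<in>{s. length s = n} \<times> N ` {..j}. cylinder (s @ u) \<inter> M = {})"
    using finite_lists_length_eq[of "UNIV :: bool set"] nd
    by (intro allI uniform_avoiding_word) auto
  then obtain u where "\<forall>j n. u j n \<noteq> [] \<and> (\<forall>(s, M)\<in>{s. length s = n} \<times> N ` {..j}. cylinder (s @ u j n) \<inter> M = {})"
    unfolding choice_iff by blast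
  then have u: "\<And>j n. u j n \<noteq> []"
    "\<And>j n s i. length s = n \<Longrightarrow> i \<le> j \<Longrightarrow> cylinder (s @ u j n) \<inter> N i = {}"
    by auto
  \<comment> \<open>\<open>w j\<close> concatenates the words of the first \<open>j\<close> blocks; its limit is the point \<open>e\<close>.\<close>
  define w where "w = rec_nat [] (\<lambda>j v. v @ u j (length v))"
  have w_Suc: "w (Suc j) = w j @ u j (length (w j))" for j
    by (simp add: w_def)
  define b where "b j = length (w j)" for j
  define e where "e i = w (Suc i) ! i" for i
  have mono: "strict_mono b"
    using u(1) by (auto simp: strict_mono_Suc_iff b_def w_Suc)
  have pre: "prefix (w i) (w j)" if "i \<le> j" for i j
    using that by (induction rule: dec_induct) (auto simp: w_Suc intro: prefix_order.trans)
  have e: "e i = w (Suc j) ! i" if "i < b (Suc j)" for i j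
  proof -
    have "i < b (Suc i)" using strict_mono_imp_increasing[OF mono, of "Suc i"] by simp
    moreover have "prefix (w (Suc i)) (w (Suc j)) \<or> prefix (w (Suc j)) (w (Suc i))"
      using pre[of "Suc i" "Suc j"] pre[of "Suc j" "Suc i"] by linarith
    ultimately show ?thesis
      using that by (auto simp: e_def b_def prefix_def nth_append)
  qed
  have "x \<notin> A" if inf: "\<exists>\<^sub>\<infinity>j. agrees_on_block e b j x" for x
  proof
    assume "x \<in> A"
    then obtain i where i: "x \<in> N i"
      using \<N>(3) ran by blast
    obtain j where j: "j \<ge> i" "agrees_on_block e b j x"
      using inf by (auto simp: INFM_nat_le)
    define s where "s = map x [0..<b j]"
    have "x \<in> cylinder (s @ u j (b j))"
      unfolding cylinder_iff
    proof (intro allI impI)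
      fix k assume k: "k < length (s @ u j (b j))"
      then have kb: "k < b (Suc j)" by (simp add: s_def w_Suc b_def)
      show "x k = (s @ u j (b j)) ! k"
      proof (cases "k < b j")
        case False
        then have "x k = e k" using j(2) kb by (simp add: agrees_on_block_def)
        also have "\<dots> = u j (b j) ! (k - b j)"
          using False e[OF kb] by (simp add: w_Suc b_def nth_append)
        finally show ?thesis using False by (simp add: s_def nth_append)
      qed (simp add: s_def nth_append)
    qed
    then show False
      using u(2)[of s "b j" i j] i j(1) by (auto simp: s_def)
  qed
  then show ?thesis using that mono by blast
qed

definition initial_segments :: "(nat \<Rightarrow> bool) set \<Rightarrow> bool list set" where
  "initial_segments C = {map x [0..<n] |x n. x \<in> C}"

lemma initial_segments_tree:
  assumes "C \<noteq> {}"
  shows "is_tree (initial_segments C)"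
  unfolding is_tree_def
proof (intro conjI ballI allI impI)
  show "initial_segments C \<noteq> {}"
    using assms by (auto simp: initial_segments_def)
next
  fix t s assume "t \<in> initial_segments C" "prefix s t"
  then obtain x n where x: "x \<in> C" "prefix s (map x [0..<n])"
    by (auto simp: initial_segments_def)
  then have "s = take (length s) (map x [0..<n])" "length s \<le> n"
    using prefix_length_le[OF x(2)] by (auto simp: prefix_def append_eq_conv_conj)
  then have "s = map x [0..<length s]"
    by (simp add: take_map)
  then show "s \<in> initial_segments C"
    using x(1) by (auto simp: initial_segments_def)
qed

text \<open>
  The pairs with index below \<^term>\<open>length s\<close> are left unconstrained because their blocks may overlap
  the part of the point that is prescribed by \<^term>\<open>s\<close>; all later blocks lie beyond it when
  \<^term>\<open>b\<close> is strictly increasing.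
\<close>
definition matching_set :: "(nat \<Rightarrow> bool) \<Rightarrow> (nat \<Rightarrow> nat) \<Rightarrow> bool list \<Rightarrow> (nat \<Rightarrow> bool) set" where
  "matching_set e b s =
     {x \<in> cylinder s. \<forall>j\<ge>length s. agrees_on_block e b (2*j) x \<or> agrees_on_block e b (2*j+1) x}"

text \<open>Replacing values of \<^term>\<open>x\<close> by values of \<^term>\<open>e\<close> cannot destroy an agreement.\<close>
lemma matching_set_extend:
  assumes "x \<in> matching_set e b s" "length s \<le> l"
  shows "(\<lambda>i. if i < l then x i else e i) \<in> matching_set e b s"
  using assms by (fastforce simp: matching_set_def cylinder_iff agrees_on_block_def)

text \<open>
  This is where pairing the blocks pays off. A coordinate \<^term>\<open>n\<close> far beyond \<^term>\<open>l\<close> lies in a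
  pair both of whose blocks start after \<^term>\<open>l\<close>, where \<^term>\<open>y\<close> copies \<^term>\<open>e\<close>. A change at
  \<^term>\<open>n\<close> spoils at most one of the two agreements, and no other pair is affected.
\<close>
lemma matching_set_flip:
  assumes y: "y \<in> matching_set e b s" and b: "strict_mono b"
    and e: "\<And>i. i \<ge> l \<Longrightarrow> y i = e i"
    and l: "length s \<le> l" and n: "b (2 * l) \<le> n"
  shows "y(n := c) \<in> matching_set e b s"
proof -
  have b_ge: "i \<le> b i" for i
    by (rule strict_mono_imp_increasing[OF b])
  have b_le: "i \<le> j \<Longrightarrow> b i \<le> b j" for i j
    using b by (simp add: strict_mono_less_eq)
  have n_l: "n \<ge> l" using b_ge[of "2 * l"] n by linarith
  have "agrees_on_block e b (2*j) (y(n := c)) \<or> agrees_on_block e b (2*j+1) (y(n := c))"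
    if j: "j \<ge> length s" for j
  proof (cases "b (2*j) \<le> n \<and> n < b (2*j+2)")
    case True
    then have "b (2*l) < b (2*j+2)" using n by linarith
    then have "l \<le> j" using b by (simp add: strict_mono_less)
    then have "l \<le> b (2*j)" using b_ge[of "2*j"] by linarith
    then have "y i = e i" if "i \<ge> b (2*j)" for i
      using that e[of i] by linarith
    moreover have "b (2*j) \<le> b (2*j+1)" by (rule b_le) simp
    ultimately show ?thesis
      by (cases "n < b (2*j+1)") (auto simp: agrees_on_block_def)
  next
    case False
    have "b (2*j) \<le> b (2*j+1)" "b (2*j+1) \<le> b (2*j+2)" by (rule b_le; simp)+
    then have "agrees_on_block e b k (y(n := c)) \<longleftrightarrow> agrees_on_block e b k y"
      if "k = 2*j \<or> k = 2*j+1" for k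
    proof -
      have "\<not> (b k \<le> n \<and> n < b (Suc k))"
        using False that \<open>b (2*j) \<le> b (2*j+1)\<close> \<open>b (2*j+1) \<le> b (2*j+2)\<close> by auto
      then show ?thesis
        unfolding agrees_on_block_def fun_upd_def by metis
    qed
    moreover have "agrees_on_block e b (2*j) y \<or> agrees_on_block e b (2*j+1) y"
      using y j by (auto simp: matching_set_def)
    ultimately show ?thesis by simp
  qed
  then show ?thesis
    using y l n_l by (auto simp: matching_set_def cylinder_iff)
qed

lemma matching_set_nonempty:
  assumes "strict_mono b"
  shows "matching_set e b s \<noteq> {}"
proof -
  let ?x = "\<lambda>i. if i < length s then s ! i else e i"
  have "agrees_on_block e b (2*j) ?x" if "j \<ge> length s" for j
    using that strict_mono_imp_increasing[OF assms, of "2*j"] by (auto simp: agrees_on_block_def)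
  then have "?x \<in> matching_set e b s"
    by (auto simp: matching_set_def cylinder_iff)
  then show ?thesis by blast
qed

text \<open>
  Given a node, follow \<^term>\<open>e\<close> after it; along this one branch every sufficiently high level
  splits, by \<open>matching_set_flip\<close>.
\<close>
lemma matching_tree_FSP:
  assumes b: "strict_mono b"
  shows "initial_segments (matching_set e b s) \<in> FSP" (is "?p \<in> FSP")
proof (rule FSP_I)
  show "is_tree ?p"
    by (intro initial_segments_tree matching_set_nonempty b)
next
  fix t assume "t \<in> ?p"
  then obtain x m where x: "x \<in> matching_set e b s" and t: "t = map x [0..<m]"
    by (auto simp: initial_segments_def)
  define l where "l = max m (length s)"
  define y where "y = (\<lambda>i. if i < l then x i else e i)"
  have y: "y \<in> matching_set e b s"
    unfolding y_def by (rule matching_set_extend[OF x]) (simp add: l_def)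
  have "\<exists>t'\<in>Split ?p. length t' = n \<and> prefix t t'" if n: "n \<ge> b (2 * l)" for n
  proof
    have mem: "map y [0..<n] @ [c] \<in> ?p" for c
    proof -
      have "y(n := c) \<in> matching_set e b s"
        by (rule matching_set_flip[OF y b _ _ n]) (auto simp: y_def l_def)
      moreover have "map y [0..<n] @ [c] = map (y(n := c)) [0..<Suc n]"
        by simp
      ultimately show ?thesis unfolding initial_segments_def by blast
    qed
    then show "map y [0..<n] \<in> Split ?p"
      using y by (auto simp: Split_def initial_segments_def)
    have mn: "m \<le> n"
      using strict_mono_imp_increasing[OF b, of "2*l"] n by (simp add: l_def)
    have "t = map y [0..<m]"
      by (auto simp: t y_def l_def)
    also have "prefix \<dots> (map y [0..<n])"
      using upt_add_eq_append[of 0 m "n - m"] mn by simp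
    finally show "length (map y [0..<n]) = n \<and> prefix t (map y [0..<n])"
      by simp
  qed
  then show "\<exists>k. \<forall>n\<ge>k. \<exists>t'\<in>Split ?p. length t' = n \<and> prefix t t'" by blast
qed

text \<open>
  The matching set is closed: each of its constraints involves finitely many coordinates, hence is
  inherited by a point all of whose initial segments extend to members.
\<close>
lemma branches_matching_tree:
  "branches (initial_segments (matching_set e b s)) \<subseteq> matching_set e b s"
proof
  fix f assume f: "f \<in> branches (initial_segments (matching_set e b s))"
  have close: "\<exists>x\<in>matching_set e b s. \<forall>i<n. f i = x i" for n
  proof -
    have "map f [0..<n] \<in> initial_segments (matching_set e b s)"
      using f by (simp add: branches_def)
    then obtain x k where "x \<in> matching_set e b s" "map f [0..<n] = map x [0..<k]"
      by (auto simp: initial_segments_def)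
    then show ?thesis
      by (metis add_0 diff_zero length_map length_upt nth_map_upt)
  qed
  have "f \<in> cylinder s"
    using close[of "length s"] by (auto simp: matching_set_def cylinder_iff)
  moreover have "agrees_on_block e b (2*j) f \<or> agrees_on_block e b (2*j+1) f" if j: "j \<ge> length s" for j
  proof -
    obtain x where x: "x \<in> matching_set e b s" "\<And>i. i < b (2*j+1) + b (2*j+2) \<Longrightarrow> f i = x i"
      using close by blast
    then show ?thesis
      using j by (fastforce simp: matching_set_def agrees_on_block_def)
  qed
  ultimately show "f \<in> matching_set e b s"
    by (simp add: matching_set_def)
qed

lemma FSP_avoiding_meager:
  assumes "meager A"
  obtains q where "q \<in> FSP" "branches q \<subseteq> cylinder s - A"
proof -
  obtain e b where b: "strict_mono b"
    and eb: "\<And>x. \<exists>\<^sub>\<infinity>j. agrees_on_block e b j x \<Longrightarrow> x \<notin> A"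
    by (rule meager_avoided_by_matching[OF assms]) (rule that)
  have "x \<notin> A" if x: "x \<in> matching_set e b s" for x
  proof (rule eb)
    show "\<exists>\<^sub>\<infinity>j. agrees_on_block e b j x"
      unfolding INFM_nat_le
    proof
      fix m
      have "agrees_on_block e b (2 * max m (length s)) x \<or> agrees_on_block e b (2 * max m (length s) + 1) x"
        using x by (auto simp: matching_set_def)
      then show "\<exists>j\<ge>m. agrees_on_block e b j x"
        by (metis max.cobounded1 mult_2 trans_le_add1)
    qed
  qed
  then have "matching_set e b s \<subseteq> cylinder s - A"
    by (auto simp: matching_set_def)
  then show ?thesis
    using that matching_tree_FSP[OF b] branches_matching_tree by blast
qed

lemma Baire_property_imp_weakly_FSP_measurable:
  assumes "Baire_property X"
  shows "weakly_FSP_measurable X"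
proof -
  obtain U where U: "open U" "meager ((X - U) \<union> (U - X))"
    using assms by (auto simp: Baire_property_def)
  show ?thesis
  proof (cases "U = {}")
    case True
    obtain q where "q \<in> FSP" "branches q \<subseteq> cylinder [] - ((X - U) \<union> (U - X))"
      using FSP_avoiding_meager[OF U(2)] by blast
    then show ?thesis
      using True by (intro weakly_FSP_measurable_if_branches_decided) auto
  next
    case False
    then obtain s where s: "cylinder s \<subseteq> U"
      using open_contains_cylinder[OF U(1)] by blast
    obtain q where "q \<in> FSP" "branches q \<subseteq> cylinder s - ((X - U) \<union> (U - X))"
      using FSP_avoiding_meager[OF U(2)] by blast
    then show ?thesis
      using s by (intro weakly_FSP_measurable_if_branches_decided) auto
  qed
qed

section \<open>Lebesgue measure\<close>

text \<open>
  The uncompleted measure, whose \<open>\<sigma>\<close>-algebra is generated by the cylinders; each set in its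
  completion differs from one of them by a null set only.
\<close>
definition coin_measure :: "(nat \<Rightarrow> bool) measure" where
  "coin_measure = (\<Pi>\<^sub>M i\<in>UNIV. measure_pmf (bernoulli_pmf (1/2)))"

interpretation coin: product_prob_space "\<lambda>_. measure_pmf (bernoulli_pmf (1/2))" "UNIV :: nat set"
  rewrites "(\<Pi>\<^sub>M i\<in>UNIV. measure_pmf (bernoulli_pmf (1/2))) = coin_measure"
  by unfold_locales (simp add: coin_measure_def)

lemma space_coin_measure [simp]: "space coin_measure = UNIV"
  by (simp add: coin_measure_def space_PiM)

lemma cylinder_measurable: "cylinder s \<in> sets coin_measure"
proof (induction s rule: rev_induct)
  case Nil
  then show ?case using sets.top[of coin_measure] by (simp add: cylinder_def)
next
  case (snoc c s)
  have "(\<lambda>x. x (length s)) \<in> coin_measure \<rightarrow>\<^sub>M measure_pmf (bernoulli_pmf (1/2))"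
    unfolding coin_measure_def by (rule measurable_component_singleton) simp
  then have "(\<lambda>x. x (length s)) -` {c} \<inter> space coin_measure \<in> sets coin_measure"
    by (rule measurable_sets) simp
  moreover have "cylinder (s @ [c]) = cylinder s \<inter> ((\<lambda>x. x (length s)) -` {c} \<inter> space coin_measure)"
    by (simp add: set_eq_iff mem_cylinder_snoc)
  ultimately show ?case using snoc by simp
qed

lemma open_measurable:
  assumes "open U"
  shows "U \<in> sets coin_measure"
proof -
  have "U = (\<Union>s\<in>{s. cylinder s \<subseteq> U}. cylinder s)"
    using open_contains_cylinder[OF assms] mem_cylinder_initial by fast
  moreover have "(\<Union>s\<in>{s. cylinder s \<subseteq> U}. cylinder s) \<in> sets coin_measure"
    using cylinder_measurable by (intro sets.countable_UN') auto
  ultimately show ?thesis by simp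
qed

lemma closed_measurable:
  assumes "closed K"
  shows "K \<in> sets coin_measure"
  using sets.compl_sets[OF open_measurable[of "- K"]] assms by (simp add: open_Compl)

lemma measure_cylinder: "measure coin_measure (cylinder s) = (1/2) ^ length s"
proof -
  have "cylinder s = {x \<in> space coin_measure. \<forall>i\<in>{..<length s}. x i \<in> {s ! i}}"
    by (auto simp: cylinder_iff)
  then have "emeasure coin_measure (cylinder s) = (\<Prod>i<length s. emeasure (measure_pmf (bernoulli_pmf (1/2))) {s ! i})"
    using coin.emeasure_PiM_Collect[of "{..<length s}" "\<lambda>i. {s ! i}"] by simp
  also have "\<dots> = (\<Prod>i<length s. ennreal (1/2))"
    by (intro prod.cong refl) (simp add: emeasure_pmf_single pmf_bernoulli_half)
  also have "\<dots> = ennreal ((1/2) ^ length s)"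
    unfolding prod_constant card_lessThan by (rule ennreal_power) simp
  finally show ?thesis by (simp add: measure_def)
qed

text \<open>
  Inner regularity is a theorem about finite Borel measures on Polish metric spaces. To apply it,
  push the measure forward along the embedding \<open>g\<close> of Cantor space as the 0-1-valued sequences
  among the real ones, find a compact set there, and pull it back. The left
  inverse \<open>h\<close> of \<open>g\<close> shows that the image of \<^term>\<open>S\<close> is Borel.
\<close>
lemma closed_subset_positive_measure:
  assumes S: "S \<in> sets coin_measure" and pos: "emeasure coin_measure S > 0"
  obtains K where "closed K" "K \<subseteq> S" "emeasure coin_measure K > 0"
proof -
  define g :: "(nat \<Rightarrow> bool) \<Rightarrow> nat \<Rightarrow> real" where "g x = (\<lambda>i. if x i then 1 else 0)" for x
  define h :: "(nat \<Rightarrow> real) \<Rightarrow> nat \<Rightarrow> bool" where "h y = (\<lambda>i. y i > 1/2)" for y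
  have hg: "h (g x) = x" for x by (auto simp: g_def h_def)
  have g_cont: "continuous_on UNIV g"
  proof (rule continuous_on_coordinatewise_then_product)
    fix i
    have "continuous_on UNIV (\<lambda>c. if c then 1 else 0 :: real)"
      by (auto simp: continuous_on_open_vimage discrete_topology_class.open_discrete)
    then have "continuous_on UNIV ((\<lambda>c. if c then 1 else 0 :: real) \<circ> (\<lambda>x :: nat \<Rightarrow> bool. x i))"
      by (intro continuous_on_compose continuous_on_product_coordinates) (auto intro: continuous_on_subset)
    then show "continuous_on UNIV (\<lambda>x. g x i)"
      by (simp add: g_def comp_def)
  qed
  then have g_meas: "g \<in> coin_measure \<rightarrow>\<^sub>M borel"
    by (intro borel_measurableI) (auto intro!: open_measurable open_vimage)
  have h_meas: "h \<in> borel \<rightarrow>\<^sub>M coin_measure"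
    unfolding coin_measure_def h_def
    by (rule measurable_PiM_single') (auto intro!: measurable_pred_countable)
  define B where "B = h -` S \<inter> {y. \<forall>i. y i = 0 \<or> y i = 1}"
  have "h -` S \<in> sets borel"
    using measurable_sets[OF h_meas S] by simp
  moreover have "{y :: nat \<Rightarrow> real. \<forall>i. y i = 0 \<or> y i = 1} \<in> sets borel"
    by measurable
  ultimately have B: "B \<in> sets borel" by (simp add: B_def)
  have gB: "g -` B = S"
    by (auto simp: B_def hg) (auto simp: g_def)
  let ?D = "distr coin_measure borel g"
  have "emeasure ?D B = emeasure coin_measure S"
    using B g_meas gB by (simp add: emeasure_distr)
  moreover have "emeasure ?D B = (SUP K \<in> {K. K \<subseteq> B \<and> compact K}. emeasure ?D K)"
    using B by (intro inner_regular) (auto simp: emeasure_distr g_meas coin.emeasure_space_1)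
  ultimately obtain K where K: "K \<subseteq> B" "compact K" "emeasure ?D K > 0"
    using pos less_SUP_iff[of 0 "emeasure ?D" "{K. K \<subseteq> B \<and> compact K}"] by auto
  have Kb: "K \<in> sets borel"
    by (intro borel_closed compact_imp_closed K(2))
  show ?thesis
  proof
    show "closed (g -` K)"
      using K(2) g_cont by (intro closed_vimage compact_imp_closed)
    show "g -` K \<subseteq> S" using K(1) gB by blast
    show "emeasure coin_measure (g -` K) > 0"
      using K(3) Kb g_meas by (simp add: emeasure_distr)
  qed
qed

text \<open>
  The measures of the sets \<^term>\<open>K \<inter> cylinder s\<close>, as a function of \<^term>\<open>s\<close>, form a finitely
  additive mass distribution on strings that is dominated by the uniform one. The counting
  argument for fatness is about such distributions and is free of measure theory.
\<close>
locale mass =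
  fixes m :: "bool list \<Rightarrow> real"
  assumes nonneg: "m s \<ge> 0"
    and additive: "m s = m (s @ [False]) + m (s @ [True])"
    and le: "m s \<le> (1/2) ^ length s"
begin

definition positive_extensions :: "bool list \<Rightarrow> nat \<Rightarrow> bool list set" where
  "positive_extensions t n = {u. length u = n \<and> m (t @ u) > 0}"

lemma finite_positive_extensions: "finite (positive_extensions t n)"
  by (rule finite_subset[OF _ finite_lists_length_eq[of "UNIV :: bool set" n]]) (auto simp: positive_extensions_def)

lemma pos_prefix: "m (s @ u) > 0 \<Longrightarrow> m s > 0"
proof (induction u rule: rev_induct)
  case (snoc c u)
  have "m (s @ u @ [c]) \<le> m (s @ u)"
    using additive[of "s @ u"] nonneg[of "s @ u @ [False]"] nonneg[of "s @ u @ [True]"]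
    by (cases c) auto
  then show ?case using snoc by simp
qed simp

text \<open>
  The mass of \<^term>\<open>t\<close> is spread over its extensions by \<^term>\<open>n\<close> bits, and each one of positive
  mass carries at most its uniform share.
\<close>
lemma le_card: "m t \<le> card (positive_extensions t n) * (1/2) ^ (length t + n)"
proof (induction n arbitrary: t)
  case 0
  have "positive_extensions t 0 = (if m t > 0 then {[]} else {})" by (auto simp: positive_extensions_def)
  then show ?case using le[of t] by auto
next
  case (Suc n)
  have eq: "positive_extensions t (Suc n) =
    Cons False ` positive_extensions (t @ [False]) n \<union> Cons True ` positive_extensions (t @ [True]) n"
  proof (rule set_eqI)
    fix v
    show "v \<in> positive_extensions t (Suc n) \<longleftrightarrow>
      v \<in> Cons False ` positive_extensions (t @ [False]) n \<union> Cons True ` positive_extensions (t @ [True]) n"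
    proof (cases v)
      case (Cons c w)
      then show ?thesis by (cases c) (auto simp: positive_extensions_def)
    qed (auto simp: positive_extensions_def)
  qed
  have "card (positive_extensions t (Suc n)) =
    card (positive_extensions (t @ [False]) n) + card (positive_extensions (t @ [True]) n)"
    unfolding eq by (subst card_Un_disjoint) (auto simp: finite_positive_extensions card_image)
  then show ?case
    using Suc[of "t @ [False]"] Suc[of "t @ [True]"] additive[of t] by (simp add: algebra_simps)
qed

lemma positive_extensions_Suc_subset:
  "positive_extensions t (Suc n) \<subseteq> (\<lambda>(u, c). u @ [c]) ` (positive_extensions t n \<times> UNIV)"
proof
  fix v assume v: "v \<in> positive_extensions t (Suc n)"
  then obtain u c where "v = u @ [c]" by (auto simp: positive_extensions_def length_Suc_conv_rev)
  then show "v \<in> (\<lambda>(u, c). u @ [c]) ` (positive_extensions t n \<times> UNIV)"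
    using v pos_prefix[of "t @ u" "[c]"] by (force simp: positive_extensions_def)
qed

lemma card_positive_extensions_Suc: "card (positive_extensions t (Suc n)) \<le> 2 * card (positive_extensions t n)"
proof -
  have "card (positive_extensions t (Suc n)) \<le> card (positive_extensions t n \<times> (UNIV :: bool set))"
    using finite_positive_extensions by (intro surj_card_le[OF _ positive_extensions_Suc_subset]) auto
  then show ?thesis by (simp add: card_cartesian_product)
qed

text \<open>Without splitting, a longer extension is determined by all but its last bit.\<close>
lemma card_positive_extensions_Suc_no_split:
  assumes "\<And>u. u \<in> positive_extensions t n \<Longrightarrow> \<not> (m (t @ u @ [False]) > 0 \<and> m (t @ u @ [True]) > 0)"
  shows "card (positive_extensions t (Suc n)) \<le> card (positive_extensions t n)"
proof (rule card_inj_on_le[OF _ _ finite_positive_extensions])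
  show "butlast ` positive_extensions t (Suc n) \<subseteq> positive_extensions t n"
    using positive_extensions_Suc_subset by fastforce
  show "inj_on butlast (positive_extensions t (Suc n))"
  proof (rule inj_onI)
    fix v w assume vw: "v \<in> positive_extensions t (Suc n)" "w \<in> positive_extensions t (Suc n)" "butlast v = butlast w"
    obtain u c where u: "u \<in> positive_extensions t n" "v = u @ [c]"
      using vw(1) positive_extensions_Suc_subset[of t n] by auto
    obtain u' d where u': "w = u' @ [d]"
      using vw(2) positive_extensions_Suc_subset[of t n] by auto
    have [simp]: "u' = u" using vw(3) u(2) u' by simp
    show "v = w"
      using assms[OF u(1)] vw u u' by (cases c; cases d) (auto simp: positive_extensions_def)
  qed
qed

text \<open>
  The normalised counts \<open>a n\<close> decrease to a limit \<open>l\<close>, which is positive by \<open>le_card\<close>. Therefore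
  \<open>2 * a (Suc n) - a n\<close> tends to \<open>l\<close> as well and is eventually positive, that is,
  the unnormalised count eventually grows at each step; every such growth needs a splitting node.
\<close>
lemma eventually_split:
  assumes "m t > 0"
  shows "\<forall>\<^sub>F n in sequentially.
    \<exists>u\<in>positive_extensions t n. m (t @ u @ [False]) > 0 \<and> m (t @ u @ [True]) > 0"
proof -
  define a where "a n = card (positive_extensions t n) * (1/2 :: real) ^ (length t + n)" for n
  have a_ge: "a n \<ge> m t" for n using le_card by (simp add: a_def)
  have "decseq a"
    unfolding decseq_Suc_iff
  proof
    fix n
    have "real (card (positive_extensions t (Suc n))) \<le> 2 * card (positive_extensions t n)"
      using card_positive_extensions_Suc[of t n] by linarith
    then show "a (Suc n) \<le> a n" by (simp add: a_def)
  qed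
  then obtain l where l: "a \<longlonglongrightarrow> l" "l \<ge> m t"
    using decseq_convergent[of a "m t"] a_ge LIMSEQ_le_const by metis
  have "(\<lambda>n. 2 * a (Suc n) - a n) \<longlonglongrightarrow> 2 * l - l"
    by (intro tendsto_intros LIMSEQ_Suc l(1))
  then have "\<forall>\<^sub>F n in sequentially. 2 * a (Suc n) - a n > 0"
    by (rule order_tendstoD(1)) (use l(2) assms in simp)
  then show ?thesis
  proof eventually_elim
    case (elim n)
    then have "card (positive_extensions t n) < card (positive_extensions t (Suc n))"
      by (simp add: a_def)
    then show ?case
      using card_positive_extensions_Suc_no_split[of t n] by force
  qed
qed

lemma positive_mass_tree_FSP:
  assumes "m [] > 0"
  shows "{s. m s > 0} \<in> FSP"
proof (rule FSP_I)
  show "is_tree {s. m s > 0}"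
    using assms pos_prefix by (auto simp: is_tree_def prefix_def)
next
  fix t assume t: "t \<in> {s. m s > 0}"
  then have "m t > 0" by simp
  then obtain k where k:
    "\<forall>n\<ge>k. \<exists>u\<in>positive_extensions t n. m (t @ u @ [False]) > 0 \<and> m (t @ u @ [True]) > 0"
    using eventually_split unfolding eventually_sequentially by meson
  have "\<exists>t'\<in>Split {s. m s > 0}. length t' = n \<and> prefix t t'" if "n \<ge> length t + k" for n
  proof -
    have "n - length t \<ge> k" using that by simp
    then obtain u where "u \<in> positive_extensions t (n - length t)" "m (t @ u @ [False]) > 0" "m (t @ u @ [True]) > 0"
      using k by blast
    then show ?thesis
      using that by (intro bexI[of _ "t @ u"]) (auto simp: Split_def positive_extensions_def)
  qed
  then show "\<exists>k. \<forall>n\<ge>k. \<exists>t'\<in>Split {s. m s > 0}. length t' = n \<and> prefix t t'" by blast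
qed

end

lemma FSP_inside_positive_measure:
  assumes S: "S \<in> sets coin_measure" and pos: "emeasure coin_measure S > 0"
  obtains q where "q \<in> FSP" "branches q \<subseteq> S"
proof -
  obtain K where K: "closed K" "K \<subseteq> S" "emeasure coin_measure K > 0"
    using closed_subset_positive_measure[OF assms] by blast
  have K_sets: "K \<in> sets coin_measure"
    using K(1) by (rule closed_measurable)
  define m where "m s = measure coin_measure (K \<inter> cylinder s)" for s
  interpret mass m
  proof
    fix s
    show "m s \<ge> 0" by (simp add: m_def)
    have "K \<inter> cylinder s = (K \<inter> cylinder (s @ [False])) \<union> (K \<inter> cylinder (s @ [True]))"
      using cylinder_snoc(1) by blast
    then show "m s = m (s @ [False]) + m (s @ [True])"
      unfolding m_def using cylinder_snoc(2)[of s] K_sets cylinder_measurable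
      by (simp add: coin.finite_measure_Union[symmetric] disjoint_iff)
    have "m s \<le> measure coin_measure (cylinder s)"
      unfolding m_def using cylinder_measurable by (intro coin.finite_measure_mono) auto
    then show "m s \<le> (1/2) ^ length s" by (simp add: measure_cylinder)
  qed
  have "m [] > 0"
    using K(3) by (simp add: m_def cylinder_def coin.emeasure_eq_measure)
  then have "{s. m s > 0} \<in> FSP" by (rule positive_mass_tree_FSP)
  moreover have "f \<in> K" if f: "f \<in> branches {s. m s > 0}" for f
  proof (rule ccontr)
    assume "f \<notin> K"
    then obtain n where "cylinder (map f [0..<n]) \<subseteq> - K"
      using open_contains_cylinder[of "- K" f] K(1) by auto
    then have "K \<inter> cylinder (map f [0..<n]) = {}" by blast
    then have "m (map f [0..<n]) = 0" by (simp add: m_def)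
    moreover have "m (map f [0..<n]) > 0" using f by (simp add: branches_def)
    ultimately show False by simp
  qed
  ultimately show ?thesis using that K(2) by blast
qed

lemma Lebesgue_measurable_imp_weakly_FSP_measurable:
  assumes "Lebesgue_measurable X"
  shows "weakly_FSP_measurable X"
proof -
  let ?M = coin_measure
  have X: "X \<in> sets (completion ?M)"
    using assms by (simp add: Lebesgue_measurable_def cantor_measure_def coin_measure_def)
  have inside: "\<exists>q\<in>FSP. branches q \<subseteq> Y"
    if Y: "Y \<in> sets (completion ?M)" "emeasure (completion ?M) Y > 0" for Y
  proof -
    have "main_part ?M Y \<in> sets ?M" "emeasure ?M (main_part ?M Y) > 0"
      using Y by simp_all
    then obtain q where "q \<in> FSP" "branches q \<subseteq> main_part ?M Y"
      using FSP_inside_positive_measure by blast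
    then show ?thesis using main_part_null_part_Un[OF Y(1)] by blast
  qed
  have X': "- X \<in> sets (completion ?M)"
    using sets.compl_sets[OF X] by (simp add: Compl_eq_Diff_UNIV)
  have "emeasure (completion ?M) X + emeasure (completion ?M) (- X) = emeasure (completion ?M) UNIV"
    using X X' by (subst plus_emeasure) auto
  also have "\<dots> = emeasure ?M UNIV"
    using sets.top[of ?M] by (subst emeasure_completion) auto
  also have "\<dots> = 1"
    using coin.emeasure_space_1 by simp
  finally have "emeasure (completion ?M) X > 0 \<or> emeasure (completion ?M) (- X) > 0"
    by (metis add_0 not_gr_zero zero_neq_one)
  then obtain q where "q \<in> FSP" "branches q \<subseteq> X \<or> branches q \<subseteq> - X"
    using inside X X' by blast
  then show ?thesis
    by (intro weakly_FSP_measurable_if_branches_decided) auto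
qed

theorem proposition7p1:
  fixes X :: "(nat \<Rightarrow> bool) set"
  shows "(Baire_property X \<longrightarrow> weakly_FSP_measurable X) \<and>
         (Lebesgue_measurable X \<longrightarrow> weakly_FSP_measurable X)"
  using Baire_property_imp_weakly_FSP_measurable Lebesgue_measurable_imp_weakly_FSP_measurable
  by blast

end
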